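(* If $n$ is a positive integer and $t$ is any integer, then $$\sum_{k=1}^n(-2)^{n-k}\frac{k}{n+k}\binom{n+k}{n-k}L_{5k+t}=\frac12\left(4^nF_{t+n+3}-F_{t-n+3}\right),$$ $$\sum_{k=1}^n(-2)^{n-k}\frac{k}{n+k}\binom{n+k}{n-k}F_{5k+t}=\frac1{10}\left(4^nL_{t+n+3}-L_{t-n+3}\right).$$
   Context: $F_n$ and $L_n$ ($n\in\mathbb{Z}$) are the Fibonacci and Lucas numbers: $F_0=0$, $F_1=1$, $F_n=F_{n-1}+F_{n-2}$; $L_0=2$, $L_1=1$, $L_n=L_{n-1}+L_{n-2}$, extended to negative indices by $F_{-n}=(-1)^{n-1}F_n$, $L_{-n}=(-1)^nL_n$. *)

theory Defs
  imports Complex_Main "HOL-Number_Theory.Fib"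
begin

fun lucas :: "nat \<Rightarrow> nat" where
  "lucas 0 = 2"
| "lucas (Suc 0) = 1"
| "lucas (Suc (Suc n)) = lucas (Suc n) + lucas n"

definition fib_int :: "int \<Rightarrow> int" where
  "fib_int m =
     (if m \<ge> 0 then int (fib (nat m)) else (- 1) ^ (nat (- m) - 1) * int (fib (nat (- m))))"

definition lucas_int :: "int \<Rightarrow> int" where
  "lucas_int m =
     (if m \<ge> 0 then int (lucas (nat m)) else (- 1) ^ nat (- m) * int (lucas (nat (- m))))"

lemma fib_int_neg: "n > 0 \<Longrightarrow> fib_int (- int n) = (- 1) ^ (n - 1) * fib_int (int n)"
  by (simp add: fib_int_def)

lemma lucas_int_neg: "lucas_int (- int n) = (- 1) ^ n * lucas_int (int n)"
  by (cases n) (simp_all add: lucas_int_def del: of_nat_Suc)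

lemma fib_int_rec: "fib_int m = fib_int (m - 1) + fib_int (m - 2)"
proof -
  consider "m \<ge> 2" | "m = 1" | "m = 0" | "m < 0" by linarith
  then show ?thesis
  proof cases
    case 1
    define k where "k = nat (m - 2)"
    have "m = int k + 2" using 1 by (simp add: k_def)
    then show ?thesis by (simp add: fib_int_def nat_add_distrib numeral_2_eq_2)
  next
    case 4
    define k where "k = nat (- m - 1)"
    have "m = - int k - 1" using 4 by (simp add: k_def)
    moreover have "nat (1 + int k) = Suc k" "nat (2 + int k) = Suc (Suc k)"
      "nat (3 + int k) = Suc (Suc (Suc k))" by linarith+
    ultimately show ?thesis by (simp add: fib_int_def add.commute) (simp add: distrib_left)
  qed (simp_all add: fib_int_def numeral_2_eq_2)
qed

lemma lucas_int_rec: "lucas_int m = lucas_int (m - 1) + lucas_int (m - 2)"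
proof -
  consider "m \<ge> 2" | "m = 1" | "m = 0" | "m < 0" by linarith
  then show ?thesis
  proof cases
    case 1
    define k where "k = nat (m - 2)"
    have "m = int k + 2" using 1 by (simp add: k_def)
    then show ?thesis by (simp add: lucas_int_def nat_add_distrib numeral_2_eq_2)
  next
    case 4
    define k where "k = nat (- m - 1)"
    have "m = - int k - 1" using 4 by (simp add: k_def)
    moreover have "nat (1 + int k) = Suc k" "nat (2 + int k) = Suc (Suc k)"
      "nat (3 + int k) = Suc (Suc (Suc k))" by linarith+
    ultimately show ?thesis by (simp add: lucas_int_def add.commute) (simp add: distrib_left)
  qed (simp_all add: lucas_int_def numeral_2_eq_2)
qed

end

theory Submission
  imports Defs
begin

text \<open>
  Since \<open>k / (n + k) * ((n + k) choose (n - k))\<close> is half of \<open>(n + k - 1) choose (2 * k - 1)\<close>, a sum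
  weighted by these numbers obeys a three-term recurrence in \<open>n\<close>, which Pascal's rule gives. The
  right-hand sides obey the same recurrence: in terms of a root \<open>\<alpha>\<close> of \<open>x\<^sup>2 = x + 1\<close>, both
  \<open>4 \<alpha>\<close> and \<open>1 / \<alpha>\<close> are roots of \<open>z\<^sup>2 = (\<alpha>\<^sup>5 - 4) z - 4\<close>. The two identities are the same statement
  for the pairs \<open>(L, F)\<close> and \<open>(5 F, L)\<close>, as \<open>L\<^sub>m = F\<^sub>m\<^sub>-\<^sub>1 + F\<^sub>m\<^sub>+\<^sub>1\<close> and
  \<open>5 F\<^sub>m = L\<^sub>m\<^sub>-\<^sub>1 + L\<^sub>m\<^sub>+\<^sub>1\<close>.
\<close>

text \<open>Pascal's rule, applied to eliminate the entry with lower index \<open>Suc r\<close>.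
  Only lower indices of one parity remain, as the family \<open>2 * j + 1\<close> requires.\<close>

lemma binomial_second_difference:
  "real (Suc (Suc N) choose Suc (Suc r))
     = real (N choose r) + 2 * real (Suc N choose Suc (Suc r)) - real (N choose Suc (Suc r))"
  by simp

text \<open>With \<open>f\<close> arbitrary, the index shift in Pascal's rule becomes a shift of
  \<open>f\<close>, so the recurrence stays within one family of sums.\<close>

lemma sum_binomial_odd_rec:
  fixes f :: "nat \<Rightarrow> real"
  defines "u \<equiv> \<lambda>m f. \<Sum>j\<le>m. real ((m + j + 1) choose (2 * j + 1)) * f j"
  shows "u (m + 2) f = u (m + 1) (\<lambda>j. f (Suc j)) + 2 * u (m + 1) f - u m f"
proof -
  define b where "b m j = real ((m + j + 1) choose (2 * j + 1))" for m j
  \<comment> \<open>\<open>b_rec\<close> does not reach \<open>j = 0\<close>; there the terms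
    balance because \<open>m + 3 = 2 * (m + 2) - (m + 1)\<close>.\<close>
  have b_0: "b m 0 = real (m + 1)" for m
    by (simp add: b_def)
  have b_rec: "b (m + 2) (Suc j) = b (m + 1) j + 2 * b (m + 1) (Suc j) - b m (Suc j)" for j
    using binomial_second_difference[of "m + j + 2" "2 * j + 1"]
    by (simp add: b_def numeral_eq_Suc del: binomial_Suc_Suc)
  \<comment> \<open>Since \<open>b m j = 0\<close> for \<open>j > m\<close>, all three sums can run
    to the same bound and be compared termwise.\<close>
  have u: "u m f = b m 0 * f 0 + (\<Sum>j\<le>M. b m (Suc j) * f (Suc j))" if "m \<le> Suc M" for m M
  proof -
    have "u m f = (\<Sum>j\<le>Suc M. b m j * f j)"
      unfolding u_def b_def using that
      by (intro sum.mono_neutral_left) (auto simp: binomial_eq_0 simp del: binomial_Suc_Suc)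
    then show ?thesis
      by (simp only: sum.atMost_Suc_shift)
  qed
  have "u (m + 1) (\<lambda>j. f (Suc j)) = (\<Sum>j\<le>m + 1. b (m + 1) j * f (Suc j))"
    by (simp only: u_def b_def)
  moreover have "u (m + 2) f = b (m + 2) 0 * f 0 + (\<Sum>j\<le>m + 1. b (m + 2) (Suc j) * f (Suc j))"
    by (rule u) simp
  moreover have "u (m + 1) f = b (m + 1) 0 * f 0 + (\<Sum>j\<le>m + 1. b (m + 1) (Suc j) * f (Suc j))"
    by (rule u) simp
  moreover have "u m f = b m 0 * f 0 + (\<Sum>j\<le>m + 1. b m (Suc j) * f (Suc j))"
    by (rule u) simp
  ultimately show ?thesis
    unfolding b_rec b_0
    by (simp add: algebra_simps sum.distrib sum_subtractf sum_distrib_left del: sum.atMost_Suc)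
qed

text \<open>Absorb \<open>(- 1 / 2) ^ j\<close> into \<open>f\<close> and pull out
  \<open>(- 2) ^ m\<close>: the coefficients 1, 2, -1 become 1, -4, -4, as a shift of
  \<open>f\<close> costs a factor -1/2.\<close>

lemma sum_binomial_odd_power_rec:
  fixes g :: "nat \<Rightarrow> real"
  defines "v \<equiv> \<lambda>m g. \<Sum>j\<le>m. (- 2) ^ (m - j) * real ((m + j + 1) choose (2 * j + 1)) * g j"
  shows "v (m + 2) g = v (m + 1) (\<lambda>j. g (Suc j)) - 4 * v (m + 1) g - 4 * v m g"
proof -
  have v: "v m g = (- 2) ^ m * (\<Sum>j\<le>m. real ((m + j + 1) choose (2 * j + 1)) * ((- 1 / 2) ^ j * g j))"
    for m g
    unfolding v_def sum_distrib_left
  proof (rule sum.cong[OF refl])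
    fix j assume "j \<in> {..m}"
    then have "(- 2 :: real) ^ m = (- 2) ^ (m - j) * (- 2) ^ j"
      by (simp flip: power_add)
    moreover have "(- 2 :: real) ^ j * (- 1 / 2) ^ j = 1"
      by (simp flip: power_mult_distrib)
    ultimately show "(- 2) ^ (m - j) * real ((m + j + 1) choose (2 * j + 1)) * g j
        = (- 2) ^ m * (real ((m + j + 1) choose (2 * j + 1)) * ((- 1 / 2) ^ j * g j))"
      by (simp add: mult_ac del: power_minus_mult)
  qed
  have shift: "(\<Sum>j\<le>m. real ((m + j + 1) choose (2 * j + 1)) * ((- 1 / 2) ^ Suc j * g (Suc j)))
      = - 1 / 2 * (\<Sum>j\<le>m. real ((m + j + 1) choose (2 * j + 1)) * ((- 1 / 2) ^ j * g (Suc j)))" for m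
    by (simp add: sum_distrib_left mult_ac)
  show ?thesis
    unfolding v sum_binomial_odd_rec[of m] shift by (simp add: algebra_simps)
qed

lemma sum_binomial_odd_fibonacci:
  fixes G H :: "int \<Rightarrow> real"
  assumes rec: "\<And>m. H m = H (m - 1) + H (m - 2)" and G: "\<And>m. G m = H (m - 1) + H (m + 1)"
  shows "(\<Sum>j\<le>m. (- 2) ^ (m - j) * real ((m + j + 1) choose (2 * j + 1)) * G (5 * int j + s))
           = 4 ^ (m + 1) * H (s + int m - 1) - H (s - int m - 3)"
proof -
  have rec': "H (a + k) = H (a + (k - 1)) + H (a + (k - 2))" for a k
    using rec[of "a + k"] by (simp add: algebra_simps)
  \<comment> \<open>Every value of \<open>H\<close> is reduced to \<open>H a\<close> and
    \<open>H (a + 1)\<close>, with Fibonacci numbers as coefficients, which leaves linear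
    identities.\<close>
  have up: "H (a + 2) = H (a + 1) + H a" "H (a + 3) = 2 * H (a + 1) + H a"
    "H (a + 4) = 3 * H (a + 1) + 2 * H a" "H (a + 5) = 5 * H (a + 1) + 3 * H a"
    "H (a + 6) = 8 * H (a + 1) + 5 * H a" "H (a + 8) = 21 * H (a + 1) + 13 * H a"
    "H (a + 10) = 55 * H (a + 1) + 34 * H a" for a
    using rec'[of a 2] rec'[of a 3] rec'[of a 4] rec'[of a 5] rec'[of a 6]
      rec'[of a 7] rec'[of a 8] rec'[of a 9] rec'[of a 10] by simp_all
  show ?thesis
  \<comment> \<open>\<open>s\<close> must vary: replacing \<open>j\<close> by \<open>Suc j\<close>
    replaces \<open>s\<close> by \<open>s + 5\<close>.\<close>
  proof (induction m arbitrary: s rule: induct_nat_012)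
    case 0
    show ?case
      using G[of s] up[of "s - 3"] by (simp add: add.commute)
  next
    case 1
    show ?case
      using G[of s] G[of "s + 5"] up[of "s - 4"]
      by (simp add: algebra_simps)
  next
    case (ge2 m)
    have "(\<Sum>j\<le>m + 2. (- 2) ^ (m + 2 - j) * real ((m + 2 + j + 1) choose (2 * j + 1)) * G (5 * int j + s))
      = (4 ^ (m + 2) * H (s + 5 + int m) - H (s + 1 - int m))
        - 4 * (4 ^ (m + 2) * H (s + int m) - H (s - int m - 4))
        - 4 * (4 ^ (m + 1) * H (s + int m - 1) - H (s - int m - 3))"
      unfolding sum_binomial_odd_power_rec[of m "\<lambda>j. G (5 * int j + s)"]
      using ge2.IH(1)[of s] ge2.IH(2)[of s] ge2.IH(2)[of "s + 5"]
      by (simp add: algebra_simps del: binomial_Suc_Suc sum.atMost_Suc)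
    \<comment> \<open>The two parts match separately, by
      \<open>H (x + 6) - 4 * H (x + 1) - H x = 4 * H (x + 2)\<close> at
      \<open>x = s + int m - 1\<close> and
      \<open>H (y + 6) - 4 * H (y + 1) - 4 * H (y + 2) = H y\<close> at
      \<open>y = s - int m - 5\<close>.\<close>
    also have "\<dots> = 4 ^ (m + 3) * H (s + int m + 1) - H (s - int m - 5)"
      using up[of "s + int m - 1"] up[of "s - int m - 5"]
      by (simp add: algebra_simps power_add)
    finally show ?case
      by (simp add: algebra_simps numeral_eq_Suc del: binomial_Suc_Suc sum.atMost_Suc)
  qed
qed

text \<open>By symmetry the lower index becomes \<open>2 * (j + 1)\<close>; absorption then cancels
  \<open>Suc m + Suc j\<close> and leaves the factor 1/2.\<close>

lemma binomial_weight_eq: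
  assumes "j \<le> m"
  shows "real (Suc j) / real (Suc m + Suc j) * real ((Suc m + Suc j) choose (Suc m - Suc j))
           = 1 / 2 * real ((m + j + 1) choose (2 * j + 1))"
proof -
  have "Suc m + Suc j choose (Suc m - Suc j) = (Suc (m + j + 1) choose Suc (2 * j + 1))"
    using assms binomial_symmetric[of "Suc m - Suc j" "Suc m + Suc j"]
    by (simp add: mult_2 del: binomial_Suc_Suc)
  moreover have "real (Suc (2 * j + 1)) * real (Suc (m + j + 1) choose Suc (2 * j + 1))
      = real (Suc (m + j + 1)) * real ((m + j + 1) choose (2 * j + 1))"
    using Suc_times_binomial[of "2 * j + 1" "m + j + 1"] by (metis of_nat_mult)
  ultimately show ?thesis
    by (simp add: field_simps del: binomial_Suc_Suc)
qed

lemma sum_weighted_fibonacci: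
  fixes G H :: "int \<Rightarrow> real"
  assumes "n > 0" and "\<And>m. H m = H (m - 1) + H (m - 2)" and "\<And>m. G m = H (m - 1) + H (m + 1)"
  shows "(\<Sum>k=1..n. (- 2) ^ (n - k) * (real k / real (n + k)) * real ((n + k) choose (n - k))
            * G (5 * int k + t))
           = 1 / 2 * (4 ^ n * H (t + int n + 3) - H (t - int n + 3))"
proof -
  obtain m where n: "n = Suc m"
    using assms(1) gr0_implies_Suc by blast
  have "(\<Sum>k=1..n. (- 2) ^ (n - k) * (real k / real (n + k)) * real ((n + k) choose (n - k))
            * G (5 * int k + t))
      = (\<Sum>j\<le>m. (- 2) ^ (n - Suc j) * (real (Suc j) / real (n + Suc j))
            * real ((n + Suc j) choose (n - Suc j)) * G (5 * int (Suc j) + t))"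
    unfolding n One_nat_def sum.shift_bounds_cl_Suc_ivl atMost_atLeast0 ..
  also have "\<dots> = (\<Sum>j\<le>m. 1 / 2 * ((- 2) ^ (m - j) * real ((m + j + 1) choose (2 * j + 1))
            * G (5 * int j + (t + 5))))"
  proof (rule sum.cong[OF refl])
    fix j assume "j \<in> {..m}"
    then have w: "real (Suc j) / real (n + Suc j) * real ((n + Suc j) choose (n - Suc j))
           = 1 / 2 * real ((m + j + 1) choose (2 * j + 1))"
      unfolding n by (intro binomial_weight_eq) simp
    have s: "5 * int (Suc j) + t = 5 * int j + (t + 5)" "n - Suc j = m - j"
      using n by simp_all
    show "(- 2) ^ (n - Suc j) * (real (Suc j) / real (n + Suc j))
            * real ((n + Suc j) choose (n - Suc j)) * G (5 * int (Suc j) + t)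
        = 1 / 2 * ((- 2) ^ (m - j) * real ((m + j + 1) choose (2 * j + 1)) * G (5 * int j + (t + 5)))"
      unfolding mult.assoc[of "(- 2) ^ (n - Suc j)" "real (Suc j) / real (n + Suc j)"] w unfolding s
      by (simp only: mult_ac)
  qed
  also have "\<dots> = 1 / 2 * (4 ^ n * H (t + int n + 3) - H (t - int n + 3))"
    unfolding sum_distrib_left[symmetric] sum_binomial_odd_fibonacci[OF assms(2,3)]
    by (simp add: n algebra_simps)
  finally show ?thesis .
qed

text \<open>Two consecutive values determine the sequence in both directions, so the induction
  carries a pair.\<close>

lemma fibonacci_rec_unique:
  fixes a b :: "int \<Rightarrow> int"
  assumes a: "\<And>m. a m = a (m - 1) + a (m - 2)" and b: "\<And>m. b m = b (m - 1) + b (m - 2)"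
    and "a 0 = b 0" "a 1 = b 1"
  shows "a m = b m"
proof -
  have "a m = b m \<and> a (m + 1) = b (m + 1)"
  proof (induction m rule: int_induct[of _ 0])
    case (step1 i)
    then show ?case using a[of "i + 2"] b[of "i + 2"] by (simp add: add.commute)
  next
    case (step2 i)
    then show ?case using a[of "i + 1"] b[of "i + 1"] by simp
  qed (use assms(3,4) in simp_all)
  then show ?thesis ..
qed

lemma lucas_int_eq_fib_int: "lucas_int m = fib_int (m - 1) + fib_int (m + 1)"
proof (rule fibonacci_rec_unique[of lucas_int "\<lambda>m. fib_int (m - 1) + fib_int (m + 1)"])
  show "fib_int (m - 1) + fib_int (m + 1)
      = fib_int (m - 1 - 1) + fib_int (m - 1 + 1) + (fib_int (m - 2 - 1) + fib_int (m - 2 + 1))" for m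
    using fib_int_rec[of "m - 1"] fib_int_rec[of "m + 1"] by (simp add: algebra_simps)
qed (rule lucas_int_rec, simp_all add: lucas_int_def fib_int_def numeral_eq_Suc)

text \<open>The right-hand side is \<open>F\<^sub>m\<^sub>-\<^sub>2 + 2 F\<^sub>m +
  F\<^sub>m\<^sub>+\<^sub>2\<close>, whose outer terms add up to \<open>3 F\<^sub>m\<close>.\<close>

lemma fib_int_eq_lucas_int: "5 * fib_int m = lucas_int (m - 1) + lucas_int (m + 1)"
  using fib_int_rec[of m] fib_int_rec[of "m + 1"] fib_int_rec[of "m + 2"]
  by (simp add: lucas_int_eq_fib_int algebra_simps)

theorem theorem16:
  fixes n :: nat and t :: int
  assumes "n > 0"
  shows "((\<Sum>k=1..n. (- 2) ^ (n - k) * (real k / real (n + k)) * real ((n + k) choose (n - k))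
            * real_of_int (lucas_int (5 * int k + t)))
         = 1 / 2 * (4 ^ n * real_of_int (fib_int (t + int n + 3))
                    - real_of_int (fib_int (t - int n + 3))))
       \<and> ((\<Sum>k=1..n. (- 2) ^ (n - k) * (real k / real (n + k)) * real ((n + k) choose (n - k))
            * real_of_int (fib_int (5 * int k + t)))
         = 1 / 10 * (4 ^ n * real_of_int (lucas_int (t + int n + 3))
                     - real_of_int (lucas_int (t - int n + 3))))"
proof
  have F: "real_of_int (fib_int m) = real_of_int (fib_int (m - 1)) + real_of_int (fib_int (m - 2))"
    and L: "real_of_int (lucas_int m) = real_of_int (lucas_int (m - 1)) + real_of_int (lucas_int (m - 2))"
    for m
    by (metis fib_int_rec of_int_add, metis lucas_int_rec of_int_add)
  show "(\<Sum>k=1..n. (- 2) ^ (n - k) * (real k / real (n + k)) * real ((n + k) choose (n - k))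
            * real_of_int (lucas_int (5 * int k + t)))
         = 1 / 2 * (4 ^ n * real_of_int (fib_int (t + int n + 3)) - real_of_int (fib_int (t - int n + 3)))"
    by (rule sum_weighted_fibonacci[OF assms F]) (simp add: lucas_int_eq_fib_int)
  \<comment> \<open>Here \<open>G\<close> is five times \<open>fib_int\<close>; dividing by this 5
    turns 1/2 into 1/10.\<close>
  have "5 * real_of_int (fib_int m) = real_of_int (lucas_int (m - 1)) + real_of_int (lucas_int (m + 1))" for m
    by (metis fib_int_eq_lucas_int of_int_add of_int_mult of_int_numeral)
  from sum_weighted_fibonacci[OF assms L this, of t]
  have "5 * (\<Sum>k=1..n. (- 2) ^ (n - k) * (real k / real (n + k)) * real ((n + k) choose (n - k))
            * real_of_int (fib_int (5 * int k + t)))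
      = 1 / 2 * (4 ^ n * real_of_int (lucas_int (t + int n + 3)) - real_of_int (lucas_int (t - int n + 3)))"
    unfolding sum_distrib_left by (simp only: mult.left_commute)
  then show "(\<Sum>k=1..n. (- 2) ^ (n - k) * (real k / real (n + k)) * real ((n + k) choose (n - k))
            * real_of_int (fib_int (5 * int k + t)))
         = 1 / 10 * (4 ^ n * real_of_int (lucas_int (t + int n + 3)) - real_of_int (lucas_int (t - int n + 3)))"
    by simp
qed

end
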